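(* Let $\Gamma\subset\widetilde{SL}_2$ be the lift to $\widetilde{SL}_2$ of one of the groups $\mathcal{F}_1(s)$ (for a fixed $s$) or $\mathcal{F}_2(\lambda)$ (for a fixed $\lambda>0$) of isometries of the hyperbolic plane $\mathcal{H}^2$. Then the standard $(-1)$-Cartan structure $(\alpha^1,\alpha^2,\alpha^3)$ on $\Sigma=\widetilde{SL}_2/\Gamma$ induces a non-trivial $(I,J,1)$-generalized Finsler structure on the 3-manifold $\Sigma$. Explicitly: there is a 1-form $\phi=\frac1y(f\,dx+g\,dy)$ on $\mathcal{H}^2$, with $f,g$ invariant under $\mathcal{F}_1(s)$, respectively $\mathcal{F}_2(\lambda)$, and $-yf_y+f+yg_x-1>0$, such that, with $v=(-yf_y+f+yg_x-1)^{-1/2}$, $$\omega^1=\frac1v\alpha^1,\qquad \omega^2=-\nu^*\phi-\alpha^3,\qquad \omega^3=\frac1v\alpha^2$$ is an $(I,J,1)$-generalized Finsler structure on $\Sigma$ with $I$ and $J$ not constant.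
   Context: $\mathcal{H}^2=\{z=x+iy: y>0\}$ carries the metric $(dx^2+dy^2)/y^2$, with orientation preserving isometry group $PSL_2(\mathbb{R})$ acting by Möbius transformations and identified with the unit tangent bundle $ST\mathcal{H}^2$. $\mathcal{F}_1(s)$ is the cyclic group generated by $\begin{pmatrix}1&s\\0&1\end{pmatrix}$ (acting by $(x,y)\mapsto(x+s,y)$), and $\mathcal{F}_2(\lambda)$ is the cyclic group generated by $\begin{pmatrix}\lambda&0\\0&1/\lambda\end{pmatrix}$ (acting by $(x,y)\mapsto\lambda^2(x,y)$). The lift of such a group is its preimage under the universal covering $\widetilde{SL}_2\to PSL_2(\mathbb{R})$. $\widetilde{SL}_2$, the universal cover of $PSL_2(\mathbb{R})\cong ST\mathcal{H}^2$, is identified with $\mathcal{H}^2\times i\mathbb{R}$ with coordinates $(x,y,\theta)$, $\nu(x,y,\theta)=(x,y)$, and its standard $(-1)$-Cartan structure is $$\alpha^1=\tfrac1y(\cos\theta\,dx+\sin\theta\,dy),\quad \alpha^2=\tfrac1y(-\sin\theta\,dx+\cos\theta\,dy),\quad \alpha^3=-d\theta-\tfrac1y dx,$$ satisfying $d\alpha^1=\alpha^2\wedge\alpha^3$, $d\alpha^2=\alpha^3\wedge\alpha^1$, $d\alpha^3=-\alpha^1\wedge\alpha^2$; it descends to left quotients. Subscripts $x,y$ are partial derivatives, and functions on $\mathcal{H}^2$ are lifted by $\nu$. An $(I,J,1)$-generalized Finsler structure on $\Sigma$ is a coframe $(\omega^1,\omega^2,\omega^3)$ with $$d\omega^1=-I\,\omega^1\wedge\omega^3+\omega^2\wedge\omega^3,\quad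 d\omega^2=-\omega^1\wedge\omega^3,\quad d\omega^3=\omega^1\wedge\omega^2-J\,\omega^1\wedge\omega^3,$$ with $I,J$ smooth functions. Non-trivial means that $I$ and $J$ are not constant on $\Sigma$. *)

theory Defs
  imports "HOL-Analysis.Analysis" "HOL-Algebra.Generated_Groups" "HOL-Algebra.Bij"
begin

section \<open>Smooth maps and differential forms in coordinates\<close>

primrec differentiable_times_on ::
    "nat \<Rightarrow> 'a::real_normed_vector set \<Rightarrow> ('a \<Rightarrow> 'b::real_normed_vector) \<Rightarrow> bool" where
  "differentiable_times_on 0 S f \<longleftrightarrow> continuous_on S f"
| "differentiable_times_on (Suc n) S f \<longleftrightarrow>
     (\<forall>p\<in>S. f differentiable (at p)) \<and>
     (\<forall>u. differentiable_times_on n S (\<lambda>p. frechet_derivative f (at p) u))"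

text \<open>Intended for open sets; on a finite-dimensional domain this is the standard notion of a
  \<open>C\<close>-infinity map.\<close>

definition smooth_on :: "'a::real_normed_vector set \<Rightarrow> ('a \<Rightarrow> 'b::real_normed_vector) \<Rightarrow> bool" where
  "smooth_on S f \<longleftrightarrow> (\<forall>n. differentiable_times_on n S f)"

text \<open>A \<open>k\<close>-form on an open subset of a vector space takes a base point, followed by \<open>k\<close> tangent
  vectors at that point.\<close>

type_synonym 'a form1 = "'a \<Rightarrow> 'a \<Rightarrow> real"
type_synonym 'a form2 = "'a \<Rightarrow> 'a \<Rightarrow> 'a \<Rightarrow> real"

definition smooth_form1_on :: "'a::real_normed_vector set \<Rightarrow> 'a form1 \<Rightarrow> bool" where
  "smooth_form1_on S \<omega> \<longleftrightarrow> (\<forall>p\<in>S. linear (\<omega> p)) \<and> (\<forall>u. smooth_on S (\<lambda>p. \<omega> p u))"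

definition wedge :: "'a form1 \<Rightarrow> 'a form1 \<Rightarrow> 'a form2"  (infixr "\<and>\<^sub>F" 75) where
  "(\<omega> \<and>\<^sub>F \<eta>) p u w = \<omega> p u * \<eta> p w - \<omega> p w * \<eta> p u"

text \<open>\<open>d\<omega>(U,W) = U(\<omega>(W)) - W(\<omega>(U)) - \<omega>([U,W])\<close> for the constant vector fields \<open>U\<close>, \<open>W\<close> with
  values \<open>u\<close>, \<open>w\<close>, whose bracket vanishes.\<close>

definition ext_deriv :: "'a::real_normed_vector form1 \<Rightarrow> 'a form2" where
  "ext_deriv \<omega> p u w =
     frechet_derivative (\<lambda>q. \<omega> q w) (at p) u - frechet_derivative (\<lambda>q. \<omega> q u) (at p) w"

definition pullback ::
    "('a::real_normed_vector \<Rightarrow> 'b::real_normed_vector) \<Rightarrow> 'b form1 \<Rightarrow> 'a form1" where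
  "pullback h \<omega> p u = \<omega> (h p) (frechet_derivative h (at p) u)"

section \<open>The hyperbolic plane and the groups of isometries\<close>

definition upper_half_plane :: "complex set"  ("\<H>\<^sup>2") where
  "\<H>\<^sup>2 = {z. Im z > 0}"

definition partial_x :: "(complex \<Rightarrow> real) \<Rightarrow> complex \<Rightarrow> real" where
  "partial_x f z = deriv (\<lambda>x. f (Complex x (Im z))) (Re z)"

definition partial_y :: "(complex \<Rightarrow> real) \<Rightarrow> complex \<Rightarrow> real" where
  "partial_y f z = deriv (\<lambda>y. f (Complex (Re z) y)) (Im z)"

definition SL2R :: "(real^2^2) monoid" where
  "SL2R = \<lparr>carrier = {A. det A = 1}, mult = (\<lambda>A B. A ** B), one = mat 1\<rparr>"

definition act :: "real^2^2 \<Rightarrow> complex \<Rightarrow> complex" where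
  "act A = moebius (complex_of_real (A $ 1 $ 1)) (complex_of_real (A $ 1 $ 2))
                   (complex_of_real (A $ 2 $ 1)) (complex_of_real (A $ 2 $ 2))"

definition F1 :: "real \<Rightarrow> (real^2^2) set" where
  "F1 s = generate SL2R {vector [vector [1, s], vector [0, 1]]}"

definition F2 :: "real \<Rightarrow> (real^2^2) set" where
  "F2 l = generate SL2R {vector [vector [l, 0], vector [0, 1 / l]]}"

definition invariant_under :: "(real^2^2) set \<Rightarrow> (complex \<Rightarrow> real) \<Rightarrow> bool" where
  "invariant_under F f \<longleftrightarrow> (\<forall>A\<in>F. \<forall>z\<in>\<H>\<^sup>2. f (act A z) = f z)"

section \<open>The universal cover of the unit tangent bundle\<close>

text \<open>The point \<open>(x + iy, \<theta>)\<close> of the universal cover lies over the unit tangent vector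
  \<open>y (cos \<theta> \<partial>\<^sub>x + sin \<theta> \<partial>\<^sub>y)\<close> at \<open>x + iy\<close>; a unit tangent vector is a pair \<open>(z, w)\<close> with
  \<open>cmod w = Im z\<close>.\<close>

definition SL2_tilde :: "(complex \<times> real) set" where
  "SL2_tilde = \<H>\<^sup>2 \<times> UNIV"

definition covering_proj :: "complex \<times> real \<Rightarrow> complex \<times> complex" where
  "covering_proj = (\<lambda>(z, \<theta>). (z, of_real (Im z) * cis \<theta>))"

definition tangent_act :: "real^2^2 \<Rightarrow> complex \<times> complex \<Rightarrow> complex \<times> complex" where
  "tangent_act A = (\<lambda>(z, w). (act A z, deriv (act A) z * w))"

text \<open>Identifying \<open>PSL\<^sub>2(\<real>)\<close> with the unit tangent bundle turns left multiplication by \<open>\<plusminus>A\<close> into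
  \<open>tangent_act A\<close>. Left multiplications by the elements of the universal covering group lying over
  \<open>\<plusminus>A\<close> are therefore exactly the continuous lifts of \<open>tangent_act A\<close>, so that the preimage of a
  subgroup, acting from the left, is the set of all lifts of its elements (it always contains
  the deck transformations \<open>\<theta> \<mapsto> \<theta> + 2\<pi>k\<close>). Elements are extensional functions, as in
  \<^const>\<open>BijGroup\<close>.\<close>

definition lift :: "(real^2^2) set \<Rightarrow> (complex \<times> real \<Rightarrow> complex \<times> real) set" where
  "lift F = {\<gamma> \<in> SL2_tilde \<rightarrow>\<^sub>E SL2_tilde. continuous_on SL2_tilde \<gamma> \<and>
     (\<exists>A\<in>F. \<forall>p\<in>SL2_tilde. covering_proj (\<gamma> p) = tangent_act A (covering_proj p))}"

definition \<alpha>1 :: "(complex \<times> real) form1" where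
  "\<alpha>1 = (\<lambda>(z, \<theta>) (w, t). (cos \<theta> * Re w + sin \<theta> * Im w) / Im z)"

definition \<alpha>2 :: "(complex \<times> real) form1" where
  "\<alpha>2 = (\<lambda>(z, \<theta>) (w, t). (- sin \<theta> * Re w + cos \<theta> * Im w) / Im z)"

definition \<alpha>3 :: "(complex \<times> real) form1" where
  "\<alpha>3 = (\<lambda>(z, \<theta>) (w, t). - t - Re w / Im z)"

section \<open>Structures on left quotients\<close>

text \<open>A free and properly discontinuous action by diffeomorphisms. The quotient
  \<open>\<Sigma> = SL2_tilde / \<Gamma>\<close> is then a smooth 3-manifold, the quotient map is a smooth covering, and
  pulling back along it identifies smooth functions and forms on \<open>\<Sigma>\<close> with the \<open>\<Gamma>\<close>-invariant ones
  upstairs; exterior derivative and wedge product are computed upstairs.\<close>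

definition quotient_is_manifold :: "(complex \<times> real \<Rightarrow> complex \<times> real) set \<Rightarrow> bool" where
  "quotient_is_manifold \<Gamma> \<longleftrightarrow>
     subgroup \<Gamma> (BijGroup SL2_tilde) \<and>
     (\<forall>\<gamma>\<in>\<Gamma>. smooth_on SL2_tilde \<gamma>) \<and>
     (\<forall>\<gamma>\<in>\<Gamma>. \<forall>p\<in>SL2_tilde. \<gamma> p = p \<longrightarrow> \<gamma> = (\<lambda>q\<in>SL2_tilde. q)) \<and>
     (\<forall>K. compact K \<and> K \<subseteq> SL2_tilde \<longrightarrow> finite {\<gamma>\<in>\<Gamma>. \<gamma> ` K \<inter> K \<noteq> {}})"

definition smooth_fun_on_quotient ::
    "(complex \<times> real \<Rightarrow> complex \<times> real) set \<Rightarrow> (complex \<times> real \<Rightarrow> real) \<Rightarrow> bool" where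
  "smooth_fun_on_quotient \<Gamma> h \<longleftrightarrow>
     smooth_on SL2_tilde h \<and> (\<forall>\<gamma>\<in>\<Gamma>. \<forall>p\<in>SL2_tilde. h (\<gamma> p) = h p)"

definition smooth_form1_on_quotient ::
    "(complex \<times> real \<Rightarrow> complex \<times> real) set \<Rightarrow> (complex \<times> real) form1 \<Rightarrow> bool" where
  "smooth_form1_on_quotient \<Gamma> \<omega> \<longleftrightarrow>
     smooth_form1_on SL2_tilde \<omega> \<and>
     (\<forall>\<gamma>\<in>\<Gamma>. \<forall>p\<in>SL2_tilde. \<forall>u. pullback \<gamma> \<omega> p u = \<omega> p u)"

definition coframe_on_quotient where
  "coframe_on_quotient \<Gamma> \<omega>1 \<omega>2 \<omega>3 \<longleftrightarrow>
     smooth_form1_on_quotient \<Gamma> \<omega>1 \<and> smooth_form1_on_quotient \<Gamma> \<omega>2 \<and>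
     smooth_form1_on_quotient \<Gamma> \<omega>3 \<and>
     (\<forall>p\<in>SL2_tilde. \<forall>a b c. (\<forall>u. a * \<omega>1 p u + b * \<omega>2 p u + c * \<omega>3 p u = 0)
        \<longrightarrow> a = 0 \<and> b = 0 \<and> c = 0)"

definition minus_one_cartan_structure where
  "minus_one_cartan_structure \<Gamma> \<omega>1 \<omega>2 \<omega>3 \<longleftrightarrow>
     coframe_on_quotient \<Gamma> \<omega>1 \<omega>2 \<omega>3 \<and>
     (\<forall>p\<in>SL2_tilde. \<forall>u w.
        ext_deriv \<omega>1 p u w = (\<omega>2 \<and>\<^sub>F \<omega>3) p u w \<and>
        ext_deriv \<omega>2 p u w = (\<omega>3 \<and>\<^sub>F \<omega>1) p u w \<and>
        ext_deriv \<omega>3 p u w = - (\<omega>1 \<and>\<^sub>F \<omega>2) p u w)"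

definition IJ1_generalized_Finsler_structure where
  "IJ1_generalized_Finsler_structure \<Gamma> I J \<omega>1 \<omega>2 \<omega>3 \<longleftrightarrow>
     smooth_fun_on_quotient \<Gamma> I \<and> smooth_fun_on_quotient \<Gamma> J \<and>
     coframe_on_quotient \<Gamma> \<omega>1 \<omega>2 \<omega>3 \<and>
     (\<forall>p\<in>SL2_tilde. \<forall>u w.
        ext_deriv \<omega>1 p u w = - I p * (\<omega>1 \<and>\<^sub>F \<omega>3) p u w + (\<omega>2 \<and>\<^sub>F \<omega>3) p u w \<and>
        ext_deriv \<omega>2 p u w = - (\<omega>1 \<and>\<^sub>F \<omega>3) p u w \<and>
        ext_deriv \<omega>3 p u w = (\<omega>1 \<and>\<^sub>F \<omega>2) p u w - J p * (\<omega>1 \<and>\<^sub>F \<omega>3) p u w)"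

text \<open>Since \<open>SL2_tilde\<close> maps onto \<open>\<Sigma>\<close>, an invariant function is constant on \<open>\<Sigma>\<close> iff it is constant
  on \<open>SL2_tilde\<close>.\<close>

definition nontrivial_IJ1_generalized_Finsler_structure where
  "nontrivial_IJ1_generalized_Finsler_structure \<Gamma> I J \<omega>1 \<omega>2 \<omega>3 \<longleftrightarrow>
     IJ1_generalized_Finsler_structure \<Gamma> I J \<omega>1 \<omega>2 \<omega>3 \<and>
     \<not> I constant_on SL2_tilde \<and> \<not> J constant_on SL2_tilde"

end

theory Submission
  imports Defs
begin

text \<open>The constant functions \<open>f = 2\<close>, \<open>g = 0\<close> already suffice, for both families of groups at once.
  They give \<open>-y f\<^sub>y + f + y g\<^sub>x - 1 = 1\<close>, hence \<open>v = 1\<close>, \<open>\<omega>\<^sup>1 = \<alpha>\<^sup>1\<close>, \<open>\<omega>\<^sup>3 = \<alpha>\<^sup>2\<close> and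
  \<open>\<omega>\<^sup>2 = -2 dx/y - \<alpha>\<^sup>3 = d\<theta> - dx/y\<close>. Since \<open>dx/y = cos \<theta> \<alpha>\<^sup>1 - sin \<theta> \<alpha>\<^sup>2\<close>, the structure equations
  hold with \<open>I = -2 cos \<theta>\<close> and \<open>J = 2 sin \<theta>\<close>.

  Both groups consist of upper triangular matrices with positive diagonal, which act by
  \<open>z \<mapsto> a z + b\<close> with \<open>a > 0\<close>; the derivative being a positive constant, the lifts are the maps
  \<open>(z, \<theta>) \<mapsto> (a z + b, \<theta> + 2\<pi>k)\<close>. They preserve every form above, and act freely and properly
  discontinuously because the matrix group is discrete.\<close>

section \<open>Smooth functions\<close>

text \<open>Near a point of an open set the two functions coincide, so their derivatives there agree
  and the argument repeats at every order. This allows maps restricted to \<open>SL2_tilde\<close>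
  to be replaced by their formulas.\<close>

lemma differentiable_times_on_cong:
  assumes "open S" "\<And>p. p \<in> S \<Longrightarrow> f p = g p" "differentiable_times_on n S f"
  shows "differentiable_times_on n S g"
  using assms(2,3)
proof (induction n arbitrary: f g)
  case 0
  then show ?case using continuous_on_cong[of S S f g] by simp
next
  case (Suc n)
  have deriv: "(g has_derivative frechet_derivative f (at p)) (at p)" if "p \<in> S" for p
    using Suc.prems that \<open>open S\<close>
    by (auto simp: frechet_derivative_works intro: has_derivative_transform_within_open)
  have "g differentiable (at p)" if "p \<in> S" for p
    using deriv[OF that] differentiableI by blast
  moreover have "frechet_derivative f (at p) u = frechet_derivative g (at p) u" if "p \<in> S" for p u
    using frechet_derivative_at[OF deriv[OF that]] by simp
  then have "differentiable_times_on n S (\<lambda>p. frechet_derivative g (at p) u)" for u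
    by (rule Suc.IH[of "\<lambda>p. frechet_derivative f (at p) u"]) (use Suc.prems(2) in simp_all)
  ultimately show ?case by simp
qed

text \<open>Replaces the chosen \<open>frechet_derivative\<close> by an explicit candidate
  \<open>f'\<close>. The inductions below for sums, products, inverses, sine and cosine all go
  through it.\<close>

lemma differentiable_times_on_SucI:
  assumes "open S" "\<And>p. p \<in> S \<Longrightarrow> (f has_derivative f' p) (at p)"
    and "\<And>u. differentiable_times_on n S (\<lambda>p. f' p u)"
  shows "differentiable_times_on (Suc n) S f"
proof -
  have deriv: "f' p = frechet_derivative f (at p)" if "p \<in> S" for p
    using that by (intro frechet_derivative_at assms(2))
  have "differentiable_times_on n S (\<lambda>p. frechet_derivative f (at p) u)" for u
    by (rule differentiable_times_on_cong[OF assms(1) _ assms(3)[of u]]) (simp add: deriv)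
  moreover have "\<forall>p\<in>S. f differentiable (at p)"
    using assms(2) differentiableI by blast
  ultimately show ?thesis unfolding differentiable_times_on.simps by blast
qed

text \<open>Derivatives of products, inverses and trigonometric functions contain the original
  functions again; this lowers their order to the one an induction hypothesis asks for.\<close>

lemma differentiable_times_on_SucD:
  "differentiable_times_on (Suc n) S f \<Longrightarrow> differentiable_times_on n S f"
proof (induction n arbitrary: f)
  case 0
  then show ?case
    by (simp add: continuous_at_imp_continuous_on differentiable_imp_continuous_within)
next
  case (Suc n)
  have "differentiable_times_on (Suc n) S (\<lambda>p. frechet_derivative f (at p) u)" for u
    using Suc.prems by simp
  note Suc.IH[OF this]
  then show ?case using Suc.prems by simp
qed

lemma differentiable_times_on_const: "differentiable_times_on n S (\<lambda>p. c)"
  by (induction n arbitrary: c) (simp_all add: frechet_derivative_const)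

lemma differentiable_times_on_affine:
  assumes "open S" "bounded_linear L"
  shows "differentiable_times_on n S (\<lambda>p. L p + c)"
proof (cases n)
  case 0
  then show ?thesis
    using assms(2) by (simp add: continuous_on_add linear_continuous_on)
next
  case (Suc m)
  have "((\<lambda>p. L p + c) has_derivative L) (at p)" for p
    by (intro has_derivative_add_const bounded_linear_imp_has_derivative assms(2))
  then show ?thesis
    unfolding Suc
    by (rule differentiable_times_on_SucI[OF assms(1), where f' = "\<lambda>p. L"])
      (auto intro: differentiable_times_on_const)
qed

lemma differentiable_times_on_add:
  assumes "open S" "differentiable_times_on n S f" "differentiable_times_on n S g"
  shows "differentiable_times_on n S (\<lambda>p. f p + g p)"
  using assms(2,3)
proof (induction n arbitrary: f g)
  case 0
  then show ?case by (simp add: continuous_on_add)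
next
  case (Suc n)
  show ?case
  proof (rule differentiable_times_on_SucI[OF \<open>open S\<close>])
    show "((\<lambda>p. f p + g p) has_derivative
      (\<lambda>u. frechet_derivative f (at p) u + frechet_derivative g (at p) u)) (at p)" if "p \<in> S" for p
      using Suc.prems that by (simp add: frechet_derivative_works has_derivative_add)
  qed (use Suc in simp)
qed

lemma differentiable_times_on_mult:
  fixes f g :: "'a::real_normed_vector \<Rightarrow> real"
  assumes "open S" "differentiable_times_on n S f" "differentiable_times_on n S g"
  shows "differentiable_times_on n S (\<lambda>p. f p * g p)"
  using assms(2,3)
proof (induction n arbitrary: f g)
  case 0
  then show ?case by (simp add: continuous_on_mult)
next
  case (Suc n)
  note prems = Suc.prems Suc.prems[THEN differentiable_times_on_SucD]
  show ?case
  proof (rule differentiable_times_on_SucI[OF \<open>open S\<close>])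
    show "((\<lambda>p. f p * g p) has_derivative
      (\<lambda>u. f p * frechet_derivative g (at p) u + frechet_derivative f (at p) u * g p)) (at p)"
      if "p \<in> S" for p
      using prems that by (simp add: frechet_derivative_works has_derivative_mult)
    show "differentiable_times_on n S
      (\<lambda>p. f p * frechet_derivative g (at p) u + frechet_derivative f (at p) u * g p)" for u
      using prems by (intro differentiable_times_on_add Suc.IH \<open>open S\<close>) auto
  qed
qed

lemma differentiable_times_on_inverse:
  fixes f :: "'a::real_normed_vector \<Rightarrow> real"
  assumes "open S" "\<And>p. p \<in> S \<Longrightarrow> f p \<noteq> 0" "differentiable_times_on n S f"
  shows "differentiable_times_on n S (\<lambda>p. inverse (f p))"
  using assms(3)
proof (induction n)
  case 0
  then show ?case using assms(2) by (simp add: continuous_on_inverse)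
next
  case (Suc n)
  note IH = Suc.IH[OF differentiable_times_on_SucD[OF Suc.prems]]
  show ?case
  proof (rule differentiable_times_on_SucI[OF \<open>open S\<close>])
    \<comment> \<open>The derivative is written with products and a constant factor
      \<open>-1\<close> only, so that it is covered by the closure rules for products and constants
      and by the induction hypothesis.\<close>
    show "((\<lambda>p. inverse (f p)) has_derivative
      (\<lambda>u. -1 * (inverse (f p) * inverse (f p) * frechet_derivative f (at p) u))) (at p)"
      if "p \<in> S" for p
      using Suc.prems that assms(2)
      by (auto simp: frechet_derivative_works algebra_simps intro!: derivative_eq_intros)
    show "differentiable_times_on n S
      (\<lambda>p. -1 * (inverse (f p) * inverse (f p) * frechet_derivative f (at p) u))" for u
      using Suc.prems
      by (intro differentiable_times_on_mult differentiable_times_on_const IH \<open>open S\<close>) auto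
  qed
qed

text \<open>Sine and cosine are treated in one induction because each appears in the derivative of
  the other.\<close>

lemma differentiable_times_on_sin_cos:
  fixes f :: "'a::real_normed_vector \<Rightarrow> real"
  assumes "open S" "differentiable_times_on n S f"
  shows "differentiable_times_on n S (\<lambda>p. sin (f p)) \<and> differentiable_times_on n S (\<lambda>p. cos (f p))"
  using assms(2)
proof (induction n)
  case 0
  then show ?case by (auto intro: continuous_on_sin continuous_on_cos)
next
  case (Suc n)
  note IH = Suc.IH[OF differentiable_times_on_SucD[OF Suc.prems]]
  have f: "(f has_derivative frechet_derivative f (at p)) (at p)" if "p \<in> S" for p
    using Suc.prems that by (simp add: frechet_derivative_works)
  have f': "differentiable_times_on n S (\<lambda>p. frechet_derivative f (at p) u)" for u
    using Suc.prems by simp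
  have "differentiable_times_on (Suc n) S (\<lambda>p. sin (f p))"
  proof (rule differentiable_times_on_SucI[OF \<open>open S\<close>])
    show "((\<lambda>p. sin (f p)) has_derivative
      (\<lambda>u. cos (f p) * frechet_derivative f (at p) u)) (at p)" if "p \<in> S" for p
      using f[OF that] by (auto intro!: derivative_eq_intros)
    show "differentiable_times_on n S (\<lambda>p. cos (f p) * frechet_derivative f (at p) u)" for u
      using IH f' by (intro differentiable_times_on_mult \<open>open S\<close>) auto
  qed
  moreover have "differentiable_times_on (Suc n) S (\<lambda>p. cos (f p))"
  proof (rule differentiable_times_on_SucI[OF \<open>open S\<close>])
    show "((\<lambda>p. cos (f p)) has_derivative
      (\<lambda>u. -1 * (sin (f p) * frechet_derivative f (at p) u))) (at p)" if "p \<in> S" for p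
      using f[OF that] by (auto intro!: derivative_eq_intros)
    show "differentiable_times_on n S (\<lambda>p. -1 * (sin (f p) * frechet_derivative f (at p) u))" for u
      using IH f' by (intro differentiable_times_on_mult differentiable_times_on_const \<open>open S\<close>) auto
  qed
  ultimately show ?case by blast
qed

lemma smooth_on_cong:
  "\<lbrakk>open S; \<And>p. p \<in> S \<Longrightarrow> f p = g p; smooth_on S f\<rbrakk> \<Longrightarrow> smooth_on S g"
  unfolding smooth_on_def using differentiable_times_on_cong by blast

lemma smooth_on_const: "smooth_on S (\<lambda>p. c)"
  by (simp add: smooth_on_def differentiable_times_on_const)

lemma smooth_on_affine:
  "\<lbrakk>open S; bounded_linear L\<rbrakk> \<Longrightarrow> smooth_on S (\<lambda>p. L p + c)"
  by (simp add: smooth_on_def differentiable_times_on_affine)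

lemma smooth_on_add:
  "\<lbrakk>open S; smooth_on S f; smooth_on S g\<rbrakk> \<Longrightarrow> smooth_on S (\<lambda>p. f p + g p)"
  by (simp add: smooth_on_def differentiable_times_on_add)

lemma smooth_on_mult:
  fixes f g :: "'a::real_normed_vector \<Rightarrow> real"
  shows "\<lbrakk>open S; smooth_on S f; smooth_on S g\<rbrakk> \<Longrightarrow> smooth_on S (\<lambda>p. f p * g p)"
  by (simp add: smooth_on_def differentiable_times_on_mult)

lemma smooth_on_divide:
  fixes f g :: "'a::real_normed_vector \<Rightarrow> real"
  assumes "open S" "smooth_on S f" "smooth_on S g" "\<And>p. p \<in> S \<Longrightarrow> g p \<noteq> 0"
  shows "smooth_on S (\<lambda>p. f p / g p)"
  unfolding divide_inverse using assms
  by (simp add: smooth_on_def differentiable_times_on_mult differentiable_times_on_inverse)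

lemma smooth_on_sin:
  fixes f :: "'a::real_normed_vector \<Rightarrow> real"
  shows "\<lbrakk>open S; smooth_on S f\<rbrakk> \<Longrightarrow> smooth_on S (\<lambda>p. sin (f p))"
  by (simp add: smooth_on_def differentiable_times_on_sin_cos)

lemma smooth_on_cos:
  fixes f :: "'a::real_normed_vector \<Rightarrow> real"
  shows "\<lbrakk>open S; smooth_on S f\<rbrakk> \<Longrightarrow> smooth_on S (\<lambda>p. cos (f p))"
  by (simp add: smooth_on_def differentiable_times_on_sin_cos)

lemma smooth_on_uminus:
  fixes f :: "'a::real_normed_vector \<Rightarrow> real"
  assumes "open S" "smooth_on S f"
  shows "smooth_on S (\<lambda>p. - f p)"
  using smooth_on_mult[OF assms(1) smooth_on_const assms(2), of "-1"] by simp

section \<open>The universal cover as an open connected domain\<close>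

lemma open_SL2_tilde: "open SL2_tilde"
  unfolding SL2_tilde_def upper_half_plane_def
  by (intro open_Times open_halfspace_Im_gt open_UNIV)

lemma mem_SL2_tilde: "p \<in> SL2_tilde \<longleftrightarrow> 0 < Im (fst p)"
  by (cases p) (auto simp: SL2_tilde_def upper_half_plane_def)

lemma connected_SL2_tilde: "connected SL2_tilde"
  unfolding SL2_tilde_def upper_half_plane_def
  by (intro convex_connected convex_Times convex_halfspace_Im_gt convex_UNIV)

lemma smooth_on_snd: "smooth_on SL2_tilde (snd :: complex \<times> real \<Rightarrow> real)"
  using smooth_on_affine[OF open_SL2_tilde bounded_linear_snd, of 0] by simp

lemma smooth_on_Im_fst: "smooth_on SL2_tilde (\<lambda>p :: complex \<times> real. Im (fst p))"
  using smooth_on_affine[OF open_SL2_tilde bounded_linear_compose[OF bounded_linear_Im bounded_linear_fst], of 0]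
  by simp

lemmas smooth_on_SL2_tilde_intros =
  smooth_on_const smooth_on_snd smooth_on_Im_fst
  smooth_on_add[OF open_SL2_tilde] smooth_on_uminus[OF open_SL2_tilde]
  smooth_on_mult[OF open_SL2_tilde] smooth_on_divide[OF open_SL2_tilde]
  smooth_on_sin[OF open_SL2_tilde] smooth_on_cos[OF open_SL2_tilde]

section \<open>Lifts of upper triangular groups\<close>

text \<open>The transformation induced by \<open>z\<close> mapping to \<open>a z + b\<close>: for
  positive \<open>a\<close> its derivative does not rotate tangent vectors, so the angle changes
  only by a deck transformation. The restriction makes it extensional, as membership in
  \<open>BijGroup\<close> demands.\<close>

definition affine_lift :: "real \<Rightarrow> real \<Rightarrow> int \<Rightarrow> complex \<times> real \<Rightarrow> complex \<times> real" where
  "affine_lift a b k = (\<lambda>p\<in>SL2_tilde. (of_real a * fst p + of_real b, snd p + 2 * pi * of_int k))"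

lemma affine_lift_apply:
  "p \<in> SL2_tilde \<Longrightarrow>
     affine_lift a b k p = (of_real a * fst p + of_real b, snd p + 2 * pi * of_int k)"
  by (simp add: affine_lift_def)

lemma affine_lift_in: "0 < a \<Longrightarrow> p \<in> SL2_tilde \<Longrightarrow> affine_lift a b k p \<in> SL2_tilde"
  by (simp add: affine_lift_def mem_SL2_tilde)

text \<open>Positivity of \<open>a'\<close> keeps the inner image inside \<open>SL2_tilde\<close>,
  where the outer map is given by its formula.\<close>

lemma affine_lift_compose:
  assumes "0 < a'"
  shows "compose SL2_tilde (affine_lift a b k) (affine_lift a' b' k')
    = affine_lift (a * a') (a * b' + b) (k + k')"
proof
  fix p
  show "compose SL2_tilde (affine_lift a b k) (affine_lift a' b' k') p
    = affine_lift (a * a') (a * b' + b) (k + k') p"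
    using affine_lift_in[OF assms, of p b' k']
    by (cases "p \<in> SL2_tilde") (auto simp: compose_def affine_lift_def algebra_simps)
qed

lemma affine_lift_id: "affine_lift 1 0 0 = (\<lambda>p\<in>SL2_tilde. p)"
  by (auto simp: affine_lift_def)

lemma has_derivative_affine_lift:
  assumes "p \<in> SL2_tilde"
  shows "(affine_lift a b k has_derivative (\<lambda>u. (of_real a * fst u, snd u))) (at p)"
proof (rule has_derivative_transform_within_open[OF _ open_SL2_tilde assms])
  show "((\<lambda>p. (of_real a * fst p + of_real b, snd p + 2 * pi * of_int k))
      has_derivative (\<lambda>u. (of_real a * fst u, snd u))) (at p)"
    by (auto intro!: derivative_eq_intros)
qed (simp add: affine_lift_def)

lemma smooth_on_affine_lift: "smooth_on SL2_tilde (affine_lift a b k)"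
proof (rule smooth_on_cong[OF open_SL2_tilde])
  have "bounded_linear (\<lambda>p :: complex \<times> real. (of_real a * fst p, snd p))"
    by (intro bounded_linear_Pair bounded_linear_const_mult bounded_linear_fst bounded_linear_snd)
  then show "smooth_on SL2_tilde
    (\<lambda>p. (of_real a * fst p, snd p) + (of_real b, 2 * pi * of_int k))"
    by (rule smooth_on_affine[OF open_SL2_tilde])
qed (simp add: affine_lift_def)

section \<open>Determinant one matrices and their upper triangular subgroups\<close>

lemma SL2R_simps:
  "A \<in> carrier SL2R \<longleftrightarrow> det A = 1" "A \<otimes>\<^bsub>SL2R\<^esub> B = A ** B" "\<one>\<^bsub>SL2R\<^esub> = mat 1"
  by (simp_all add: SL2R_def)

lemma group_SL2R: "group SL2R"
proof (rule groupI)
  fix A :: "real^2^2" assume "A \<in> carrier SL2R"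
  then have A: "det A = 1" by (simp add: SL2R_simps)
  then obtain B where "B ** A = mat 1"
    using invertible_det_nz[of A] by (auto simp: invertible_def)
  moreover from this A have "det B = 1"
    by (metis det_I det_mul mult.right_neutral)
  ultimately show "\<exists>B\<in>carrier SL2R. B \<otimes>\<^bsub>SL2R\<^esub> A = \<one>\<^bsub>SL2R\<^esub>"
    by (auto simp: SL2R_simps)
qed (auto simp: SL2R_simps det_mul matrix_mul_assoc)

text \<open>Common ground of the two families. Discreteness is kept out of the locale and enters
  only with proper discontinuity, as finiteness of the set of elements with bounded entries.\<close>

locale upper_triangular_subgroup =
  fixes F :: "(real^2^2) set"
  assumes subgroup_F: "subgroup F SL2R"
    and lower_left: "A \<in> F \<Longrightarrow> A $ 2 $ 1 = 0"
    and upper_left: "A \<in> F \<Longrightarrow> 0 < A $ 1 $ 1"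
begin

text \<open>With lower row \<open>(0, 1/a)\<close> the Moebius map \<open>(a z + b) / (1/a)\<close>
  equals \<open>a^2 z + a b\<close>, which gives the two coefficients.\<close>

definition matrix_lift :: "real^2^2 \<Rightarrow> int \<Rightarrow> complex \<times> real \<Rightarrow> complex \<times> real" where
  "matrix_lift A = affine_lift ((A $ 1 $ 1)\<^sup>2) (A $ 1 $ 1 * A $ 1 $ 2)"

lemma lower_right: "A \<in> F \<Longrightarrow> A $ 1 $ 1 * A $ 2 $ 2 = 1"
  using subgroup.subset[OF subgroup_F] lower_left by (fastforce simp: SL2R_simps det_2)

lemma act_eq:
  assumes "A \<in> F"
  shows "act A z = of_real ((A $ 1 $ 1)\<^sup>2) * z + of_real (A $ 1 $ 1 * A $ 1 $ 2)"
proof -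
  have "A $ 2 $ 2 = inverse (A $ 1 $ 1)"
    using lower_right[OF assms] by (metis inverse_unique)
  then have "complex_of_real (A $ 2 $ 2) = inverse (of_real (A $ 1 $ 1))"
    by simp
  then show ?thesis
    using lower_left[OF assms]
    by (simp add: act_def moebius_def divide_inverse algebra_simps power2_eq_square)
qed

lemma deriv_act:
  assumes "A \<in> F"
  shows "deriv (act A) z = of_real ((A $ 1 $ 1)\<^sup>2)"
proof -
  have "act A = (\<lambda>z. of_real ((A $ 1 $ 1)\<^sup>2) * z + of_real (A $ 1 $ 1 * A $ 1 $ 2))"
    using act_eq[OF assms] by blast
  then show ?thesis
    by (auto intro!: DERIV_imp_deriv derivative_eq_intros)
qed

text \<open>The base point of \<open>q\<close> is forced. The tangent vectors then have the same
  nonzero length factor, which cancels and leaves equality of the two angles modulo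
  \<open>2 pi\<close>.\<close>

lemma covers_iff:
  assumes "A \<in> F" "p \<in> SL2_tilde"
  shows "covering_proj q = tangent_act A (covering_proj p) \<longleftrightarrow> (\<exists>k. q = matrix_lift A k p)"
proof -
  obtain z t z' t' where pq: "p = (z, t)" "q = (z', t')" by (cases p, cases q)
  define a where "a = (A $ 1 $ 1)\<^sup>2"
  have z: "of_real a * of_real (Im z) \<noteq> (0 :: complex)"
    using upper_left[OF assms(1)] assms(2) by (auto simp: mem_SL2_tilde pq a_def)
  have "covering_proj q = tangent_act A (covering_proj p) \<longleftrightarrow>
      z' = act A z \<and> of_real (Im z') * cis t' = of_real a * of_real (Im z) * cis t"
    by (auto simp: pq covering_proj_def tangent_act_def deriv_act[OF assms(1)] a_def)
  also have "\<dots> \<longleftrightarrow> z' = act A z \<and> cis t' = cis t"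
    using z by (auto simp: act_eq[OF assms(1)] a_def)
  also have "cis t' = cis t \<longleftrightarrow> (\<exists>k :: int. t' = t + 2 * pi * k)"
    using sin_cos_eq_iff[of t' t] by (auto simp: complex_eq_iff)
  finally show ?thesis
    using assms(2) by (auto simp: pq matrix_lift_def affine_lift_apply act_eq[OF assms(1)])
qed

text \<open>Pointwise, \<open>covers_iff\<close> provides an integer that may depend on the point;
  continuity on a connected domain makes it a single integer.\<close>

lemma lift_eq: "lift F = {matrix_lift A k | A k. A \<in> F}"
proof (intro equalityI subsetI)
  fix \<gamma> assume "\<gamma> \<in> lift F"
  then obtain A where \<gamma>: "\<gamma> \<in> extensional SL2_tilde" "continuous_on SL2_tilde \<gamma>" "A \<in> F"
    and "\<forall>p\<in>SL2_tilde. covering_proj (\<gamma> p) = tangent_act A (covering_proj p)"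
    by (auto simp: lift_def PiE_def)
  then have "\<forall>p\<in>SL2_tilde. \<exists>k. \<gamma> p = matrix_lift A k p"
    by (simp add: covers_iff)
  then obtain k where k: "\<gamma> p = matrix_lift A (k p) p" if "p \<in> SL2_tilde" for p
    by metis
  \<comment> \<open>The change of angle, a continuous function with values in the multiples of
    \<open>2 pi\<close>.\<close>
  define h where "h = (\<lambda>p. snd (\<gamma> p) - snd p)"
  have h: "h p = 2 * pi * of_int (k p)" if "p \<in> SL2_tilde" for p
    using that by (simp add: h_def k matrix_lift_def affine_lift_apply)
  have "h constant_on SL2_tilde"
  proof (rule continuous_discrete_range_constant[OF connected_SL2_tilde])
    show "continuous_on SL2_tilde h"
      unfolding h_def using \<gamma>(2) by (intro continuous_intros)
    \<comment> \<open>Distinct values of \<open>h\<close> stay at least \<open>2 pi\<close> apart,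
      so the range of \<open>h\<close> is discrete.\<close>
    have "2 * pi \<le> norm (h q - h p)"
      if "p \<in> SL2_tilde" "q \<in> SL2_tilde" "h q \<noteq> h p" for p q
    proof -
      have "1 \<le> \<bar>k q - k p\<bar>" using that h by auto
      then have "1 \<le> \<bar>real_of_int (k q) - real_of_int (k p)\<bar>" by linarith
      moreover have "h q - h p = 2 * pi * (real_of_int (k q) - real_of_int (k p))"
        using that h by (simp add: algebra_simps)
      ultimately show ?thesis by (simp add: abs_mult)
    qed
    then show "\<exists>e>0. \<forall>q. q \<in> SL2_tilde \<and> h q \<noteq> h p \<longrightarrow> e \<le> norm (h q - h p)"
      if "p \<in> SL2_tilde" for p
      using that pi_gt_zero by (intro exI[of _ "2 * pi"]) auto
  qed
  then obtain c where "h p = c" if "p \<in> SL2_tilde" for p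
    unfolding constant_on_def by blast
  \<comment> \<open>The point \<open>(\<i>, 0)\<close> is an arbitrary reference point at which the
    constant integer is read off.\<close>
  then have "k p = k (\<i>, 0)" if "p \<in> SL2_tilde" for p
    using h[OF that] h[of "(\<i>, 0)"] that by (simp add: mem_SL2_tilde)
  then have "\<gamma> = matrix_lift A (k (\<i>, 0))"
    using \<gamma>(1) k by (intro extensionalityI[of _ SL2_tilde]) (auto simp: matrix_lift_def affine_lift_def)
  then show "\<gamma> \<in> {matrix_lift A k | A k. A \<in> F}" using \<gamma>(3) by blast
next
  fix \<gamma> assume "\<gamma> \<in> {matrix_lift A k | A k. A \<in> F}"
  then obtain A k where \<gamma>: "\<gamma> = matrix_lift A k" "A \<in> F" by blast
  have "\<gamma> \<in> SL2_tilde \<rightarrow>\<^sub>E SL2_tilde"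
    using upper_left[OF \<gamma>(2)]
    by (auto simp: \<gamma>(1) matrix_lift_def affine_lift_def mem_SL2_tilde simp del: of_real_power)
  moreover have "continuous_on SL2_tilde \<gamma>"
    using smooth_on_affine_lift unfolding \<gamma>(1) matrix_lift_def smooth_on_def
    by (metis differentiable_times_on.simps(1))
  ultimately show "\<gamma> \<in> lift F"
    using covers_iff[OF \<gamma>(2)] \<gamma> unfolding lift_def by blast
qed

section \<open>The lift as a group: composition, free action, proper discontinuity\<close>

lemma matrix_lift_compose:
  assumes "A \<in> F" "B \<in> F"
  shows "compose SL2_tilde (matrix_lift A j) (matrix_lift B k) = matrix_lift (A ** B) (j + k)"
proof -
  \<comment> \<open>On the left stands the translation part of the composed affine maps, on the
    right the one read off from the matrix product; they agree because the diagonal entries of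
    \<open>B\<close> have product one.\<close>
  have "(A $ 1 $ 1)\<^sup>2 * (B $ 1 $ 1 * B $ 1 $ 2) + A $ 1 $ 1 * A $ 1 $ 2
      = A $ 1 $ 1 * B $ 1 $ 1 * (A $ 1 $ 1 * B $ 1 $ 2 + A $ 1 $ 2 * B $ 2 $ 2)"
    using lower_right[OF assms(2)] by algebra
  then show ?thesis
    unfolding matrix_lift_def using upper_left[OF assms(2)] lower_left[OF assms(2)]
    by (simp add: affine_lift_compose matrix_matrix_mult_def sum_2 power_mult_distrib)
qed

lemma matrix_lift_one: "matrix_lift (mat 1) 0 = (\<lambda>p\<in>SL2_tilde. p)"
  by (simp add: matrix_lift_def mat_def affine_lift_id)

lemma one_mem: "mat 1 \<in> F"
  using subgroup.one_closed[OF subgroup_F] by (simp add: SL2R_simps)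

lemma mult_mem: "A \<in> F \<Longrightarrow> B \<in> F \<Longrightarrow> A ** B \<in> F"
  using subgroup.m_closed[OF subgroup_F] by (simp add: SL2R_simps)

lemma inverse_mem:
  assumes "A \<in> F"
  obtains B where "B \<in> F" "A ** B = mat 1" "B ** A = mat 1"
proof
  interpret group SL2R by (rule group_SL2R)
  show "inv\<^bsub>SL2R\<^esub> A \<in> F"
    using subgroup.m_inv_closed[OF subgroup_F assms] .
  have "A \<in> carrier SL2R" using subgroup.subset[OF subgroup_F] assms by blast
  then show "A ** inv\<^bsub>SL2R\<^esub> A = mat 1" "inv\<^bsub>SL2R\<^esub> A ** A = mat 1"
    using r_inv l_inv by (simp_all add: SL2R_simps)
qed

text \<open>The inverse matrix with the opposite deck shift gives an inverse that is again a lift.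
  Both bijectivity and closure under inverses follow from this.\<close>

lemma lift_inverse:
  assumes "\<gamma> \<in> lift F"
  obtains \<delta> where "\<delta> \<in> lift F" "compose SL2_tilde \<gamma> \<delta> = (\<lambda>p\<in>SL2_tilde. p)"
    "compose SL2_tilde \<delta> \<gamma> = (\<lambda>p\<in>SL2_tilde. p)"
proof -
  obtain A k where A: "A \<in> F" "\<gamma> = matrix_lift A k" using assms by (auto simp: lift_eq)
  obtain B where B: "B \<in> F" "A ** B = mat 1" "B ** A = mat 1" using inverse_mem[OF A(1)] .
  show ?thesis
  proof
    show "matrix_lift B (- k) \<in> lift F" using B by (auto simp: lift_eq)
  qed (simp_all add: A B matrix_lift_compose matrix_lift_one)
qed

lemma lift_subset_Bij: "lift F \<subseteq> Bij SL2_tilde"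
proof
  fix \<gamma> assume \<gamma>: "\<gamma> \<in> lift F"
  then obtain \<delta> where \<delta>: "\<delta> \<in> lift F" "compose SL2_tilde \<gamma> \<delta> = (\<lambda>p\<in>SL2_tilde. p)"
    "compose SL2_tilde \<delta> \<gamma> = (\<lambda>p\<in>SL2_tilde. p)"
    by (rule lift_inverse)
  have "bij_betw \<gamma> SL2_tilde SL2_tilde"
  proof (rule bij_betw_byWitness[of _ \<delta>])
    show "\<forall>p\<in>SL2_tilde. \<delta> (\<gamma> p) = p" "\<forall>p\<in>SL2_tilde. \<gamma> (\<delta> p) = p"
      using \<delta>(2,3) by (metis compose_eq restrict_apply')+
  qed (use \<gamma> \<delta>(1) in \<open>auto simp: lift_def\<close>)
  then show "\<gamma> \<in> Bij SL2_tilde" using \<gamma> by (auto simp: Bij_def lift_def PiE_def)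
qed

lemma subgroup_lift: "subgroup (lift F) (BijGroup SL2_tilde)"
proof -
  interpret Bij: group "BijGroup SL2_tilde" by (rule group_BijGroup)
  have compose: "\<gamma> \<otimes>\<^bsub>BijGroup SL2_tilde\<^esub> \<delta> = compose SL2_tilde \<gamma> \<delta>"
    if "\<gamma> \<in> lift F" "\<delta> \<in> lift F" for \<gamma> \<delta>
    using that lift_subset_Bij by (auto simp: BijGroup_def)
  show ?thesis
  proof (rule Bij.subgroupI)
    show "lift F \<subseteq> carrier (BijGroup SL2_tilde)"
      using lift_subset_Bij by (simp add: BijGroup_def)
    then have carrier: "\<gamma> \<in> carrier (BijGroup SL2_tilde)" if "\<gamma> \<in> lift F" for \<gamma>
      using that by blast
    show "lift F \<noteq> {}" using one_mem by (auto simp: lift_eq)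
    fix \<gamma> assume \<gamma>: "\<gamma> \<in> lift F"
    obtain \<delta> where \<delta>: "\<delta> \<in> lift F" "compose SL2_tilde \<delta> \<gamma> = (\<lambda>p\<in>SL2_tilde. p)"
      using lift_inverse[OF \<gamma>] by metis
    have "inv\<^bsub>BijGroup SL2_tilde\<^esub> \<gamma> = \<delta>"
      using \<delta> \<gamma> carrier compose by (intro Bij.inv_equality) (auto simp: BijGroup_def)
    then show "inv\<^bsub>BijGroup SL2_tilde\<^esub> \<gamma> \<in> lift F" using \<delta> by simp
    show "\<gamma> \<otimes>\<^bsub>BijGroup SL2_tilde\<^esub> \<delta>' \<in> lift F" if "\<delta>' \<in> lift F" for \<delta>'
      using \<gamma> that mult_mem matrix_lift_compose unfolding compose[OF \<gamma> that] lift_eq by blast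
  qed
qed

text \<open>A fixed point forces \<open>k = 0\<close> through the angle, then scaling factor one
  through the positive imaginary part, and finally zero translation.\<close>

lemma lift_free:
  assumes "\<gamma> \<in> lift F" "p \<in> SL2_tilde" "\<gamma> p = p"
  shows "\<gamma> = (\<lambda>q\<in>SL2_tilde. q)"
proof -
  obtain A k where A: "A \<in> F" "\<gamma> = matrix_lift A k" using assms(1) by (auto simp: lift_eq)
  define a b where "a = (A $ 1 $ 1)\<^sup>2" and "b = A $ 1 $ 1 * A $ 1 $ 2"
  have fix_point: "of_real a * fst p + of_real b = fst p" "k = 0"
    using assms(2,3) by (auto simp: A matrix_lift_def affine_lift_apply a_def b_def prod_eq_iff)
  have "a * Im (fst p) = Im (fst p)" using arg_cong[OF fix_point(1), of Im] by simp
  then have "a = 1" using assms(2) by (simp add: mem_SL2_tilde)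
  then have "b = 0" using fix_point(1) by simp
  with \<open>a = 1\<close> fix_point(2) show ?thesis
    by (simp add: A matrix_lift_def affine_lift_id flip: a_def b_def)
qed

text \<open>If a lift carries a point of \<open>K\<close> into \<open>K\<close>, then compactness
  bounds the entries of its matrix and its deck shift. Discreteness leaves finitely many such
  matrices, and the bounded integers are finite in number as well.\<close>

lemma lift_properly_discontinuous:
  assumes discrete: "\<And>C. finite {A \<in> F. \<forall>i j. \<bar>A $ i $ j\<bar> \<le> C}"
    and K: "compact K" "K \<subseteq> SL2_tilde"
  shows "finite {\<gamma> \<in> lift F. \<gamma> ` K \<inter> K \<noteq> {}}"
proof (cases "K = {}")
  case False
  obtain M where M: "0 < M" "\<And>p. p \<in> K \<Longrightarrow> norm p \<le> M"
    using compact_imp_bounded[OF K(1)] by (auto simp: bounded_pos)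
  have norm_K: "\<bar>Re (fst p)\<bar> \<le> M" "\<bar>Im (fst p)\<bar> \<le> M" "\<bar>snd p\<bar> \<le> M" if "p \<in> K" for p
    using M(2)[OF that] norm_fst_le[of "fst p" "snd p"] norm_snd_le[of "snd p" "fst p"]
      abs_Re_le_cmod[of "fst p"] abs_Im_le_cmod[of "fst p"]
    unfolding prod.collapse real_norm_def by linarith+
  have "continuous_on K (\<lambda>p. Im (fst p))" by (intro continuous_intros)
  then obtain p0 where p0: "p0 \<in> K" "\<And>p. p \<in> K \<Longrightarrow> Im (fst p0) \<le> Im (fst p)"
    using continuous_attains_inf[OF K(1) False] by blast
  \<comment> \<open>\<open>e\<close> is the least height in \<open>K\<close>, positive since it is
    attained inside the half plane. Heights in \<open>K\<close> are at most \<open>M\<close>, so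
    \<open>R\<close> bounds every quotient of two of them.\<close>
  define e R where "e = Im (fst p0)" and "R = M / e"
  have e: "0 < e" using p0(1) K(2) by (auto simp: e_def mem_SL2_tilde)
  \<comment> \<open>Chosen to dominate both \<open>1 + R\<close>, the bound for the diagonal, and
    \<open>(1 + R) * (M + R * M)\<close>, the bound for the upper right entry.\<close>
  define C where "C = (1 + R) * (1 + M + R * M)"
  have R: "0 < R" using e M(1) by (simp add: R_def)
  have ratio: "x \<le> R" if "x * Im (fst p) = Im (fst q)" "p \<in> K" "q \<in> K" "0 < x" for x p q
  proof -
    have "x * e \<le> x * Im (fst p)" using p0(2)[OF that(2)] that(4) by (simp add: e_def)
    also have "\<dots> \<le> M" using that(1) norm_K(2)[OF that(3)] by simp
    finally show ?thesis using e by (simp add: R_def pos_le_divide_eq)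
  qed
  \<comment> \<open>Turns bounds on squared diagonal entries into bounds on the entries without
    square roots.\<close>
  have le_square: "x \<le> 1 + x\<^sup>2" for x :: real
    using zero_le_power2[of "x - 1 / 2"] by (simp add: power2_eq_square algebra_simps)
  have bound: "(\<forall>i j. \<bar>A $ i $ j\<bar> \<le> C) \<and> \<bar>of_int k\<bar> \<le> M"
    if A: "A \<in> F" and p: "p \<in> K" "matrix_lift A k p \<in> K" for A k p
  proof -
    define q where "q = matrix_lift A k p"
    have q: "q \<in> K" "fst q = of_real ((A $ 1 $ 1)\<^sup>2) * fst p + of_real (A $ 1 $ 1 * A $ 1 $ 2)"
      "snd q = snd p + 2 * pi * k"
      using p subsetD[OF K(2) p(1)] by (simp_all add: q_def matrix_lift_def affine_lift_apply)
    have pos: "0 < A $ 1 $ 1" "A $ 1 $ 1 * A $ 2 $ 2 = 1"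
      using A by (auto intro: upper_left lower_right)
    then have pos': "0 < A $ 2 $ 2" by (metis zero_less_mult_pos zero_less_one)
    have Im: "(A $ 1 $ 1)\<^sup>2 * Im (fst p) = Im (fst q)" using q by simp
    \<comment> \<open>The lower right entry is the reciprocal of the upper left one, so its square
      is the inverse ratio of heights and \<open>ratio\<close> applies with \<open>p\<close> and
      \<open>q\<close> exchanged.\<close>
    have "(A $ 2 $ 2)\<^sup>2 * Im (fst q) = (A $ 1 $ 1 * A $ 2 $ 2)\<^sup>2 * Im (fst p)"
      unfolding Im[symmetric] by algebra
    then have Im': "(A $ 2 $ 2)\<^sup>2 * Im (fst q) = Im (fst p)" using pos(2) by simp
    have sq: "(A $ 1 $ 1)\<^sup>2 \<le> R" "(A $ 2 $ 2)\<^sup>2 \<le> R"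
      using ratio[OF Im p(1) q(1)] ratio[OF Im' q(1) p(1)] pos pos' by simp_all
    then have diag: "A $ 1 $ 1 \<le> 1 + R" "A $ 2 $ 2 \<le> 1 + R"
      using le_square[of "A $ 1 $ 1"] le_square[of "A $ 2 $ 2"] by linarith+
    have "A $ 1 $ 1 * A $ 1 $ 2 = Re (fst q) - (A $ 1 $ 1)\<^sup>2 * Re (fst p)" using q by simp
    also have "\<bar>\<dots>\<bar> \<le> \<bar>Re (fst q)\<bar> + (A $ 1 $ 1)\<^sup>2 * \<bar>Re (fst p)\<bar>"
      using abs_triangle_ineq4[of "Re (fst q)" "(A $ 1 $ 1)\<^sup>2 * Re (fst p)"] by (simp add: abs_mult)
    also have "\<dots> \<le> M + R * M"
      using norm_K(1)[OF q(1)] norm_K(1)[OF p(1)] sq(1) R by (intro add_mono mult_mono) auto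
    finally have "\<bar>A $ 1 $ 1 * A $ 1 $ 2\<bar> \<le> M + R * M" .
    then have "A $ 2 $ 2 * \<bar>A $ 1 $ 1 * A $ 1 $ 2\<bar> \<le> (1 + R) * (M + R * M)"
      using diag pos' R M(1) by (intro mult_mono) auto
    \<comment> \<open>The translation part only controls the product of the entries in the first
      row; multiplying by the reciprocal diagonal entry isolates the upper right one.\<close>
    moreover have "A $ 2 $ 2 * \<bar>A $ 1 $ 1 * A $ 1 $ 2\<bar> = \<bar>A $ 1 $ 2\<bar>"
    proof -
      have "A $ 2 $ 2 * \<bar>A $ 1 $ 1 * A $ 1 $ 2\<bar> = (A $ 1 $ 1 * A $ 2 $ 2) * \<bar>A $ 1 $ 2\<bar>"
        using pos(1) by (simp add: abs_mult)
      then show ?thesis using pos(2) by simp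
    qed
    ultimately have upper: "\<bar>A $ 1 $ 2\<bar> \<le> (1 + R) * (M + R * M)" by simp
    have RM: "0 \<le> R * M" using R M(1) by simp
    have "(1 + R) * (M + R * M) \<le> C" "1 + R \<le> C" "0 \<le> C"
      using R M(1) RM by (auto simp: C_def algebra_simps)
    then have "\<bar>A $ i $ j\<bar> \<le> C" for i j
      using upper diag pos pos' lower_left[OF A] exhaust_2[of i] exhaust_2[of j] by auto
    moreover have "2 * pi * \<bar>of_int k\<bar> = \<bar>snd q - snd p\<bar>"
      using q(3) by (simp add: abs_mult)
    then have "2 * pi * \<bar>of_int k\<bar> \<le> 2 * M"
      using norm_K(3)[OF p(1)] norm_K(3)[OF q(1)] by linarith
    then have "pi * \<bar>real_of_int k\<bar> \<le> M" by simp
    \<comment> \<open>Since \<open>pi\<close> exceeds one it may be dropped, which leaves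
      \<open>M\<close> itself as the bound for the deck shift.\<close>
    moreover have "1 * \<bar>real_of_int k\<bar> \<le> pi * \<bar>real_of_int k\<bar>"
      using pi_gt3 by (intro mult_right_mono) auto
    ultimately show ?thesis by auto
  qed
  have "{\<gamma> \<in> lift F. \<gamma> ` K \<inter> K \<noteq> {}} \<subseteq>
      (\<lambda>(A, k). matrix_lift A k) ` ({A \<in> F. \<forall>i j. \<bar>A $ i $ j\<bar> \<le> C} \<times> {- \<lceil>M\<rceil>..\<lceil>M\<rceil>})"
  proof
    fix \<gamma> assume "\<gamma> \<in> {\<gamma> \<in> lift F. \<gamma> ` K \<inter> K \<noteq> {}}"
    then obtain A k p where A: "A \<in> F" "\<gamma> = matrix_lift A k" "p \<in> K" "matrix_lift A k p \<in> K"
      unfolding lift_eq by blast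
    have "k \<in> {- \<lceil>M\<rceil>..\<lceil>M\<rceil>}" using bound[OF A(1,3,4)] by (auto simp: le_ceiling_iff) linarith+
    then show "\<gamma> \<in> (\<lambda>(A, k). matrix_lift A k) ` ({A \<in> F. \<forall>i j. \<bar>A $ i $ j\<bar> \<le> C} \<times> {- \<lceil>M\<rceil>..\<lceil>M\<rceil>})"
      using A(1,2) bound[OF A(1,3,4)] by (intro image_eqI[of _ _ "(A, k)"]) auto
  qed
  then show ?thesis
    by (rule finite_subset) (intro finite_imageI finite_cartesian_product discrete, simp)
qed simp

lemma quotient_is_manifold_lift:
  assumes "\<And>C. finite {A \<in> F. \<forall>i j. \<bar>A $ i $ j\<bar> \<le> C}"
  shows "quotient_is_manifold (lift F)"
  unfolding quotient_is_manifold_def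
proof (intro conjI ballI allI impI)
  show "smooth_on SL2_tilde \<gamma>" if "\<gamma> \<in> lift F" for \<gamma>
    using that by (auto simp: lift_eq matrix_lift_def smooth_on_affine_lift)
  show "\<gamma> = (\<lambda>q\<in>SL2_tilde. q)" if "\<gamma> \<in> lift F" "p \<in> SL2_tilde" "\<gamma> p = p" for \<gamma> p
    using that by (rule lift_free)
  show "finite {\<gamma> \<in> lift F. \<gamma> ` K \<inter> K \<noteq> {}}" if "compact K \<and> K \<subseteq> SL2_tilde" for K
    using that by (intro lift_properly_discontinuous assms) auto
qed (rule subgroup_lift)

end

section \<open>Cyclic groups inside one-parameter groups, and their discreteness\<close>

lemma cyclic_subset_one_parameter:
  assumes "\<And>s t. M (s + t) = M s ** M t" "M 0 = mat 1" "\<And>t. det (M t) = 1"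
  shows "generate SL2R {M c} \<subseteq> range (\<lambda>n :: int. M (of_int n * c))"
proof
  interpret group SL2R by (rule group_SL2R)
  fix A assume "A \<in> generate SL2R {M c}"
  then show "A \<in> range (\<lambda>n :: int. M (of_int n * c))"
  proof induction
    case one
    show ?case using assms(2) by (intro image_eqI[of _ _ 0]) (auto simp: SL2R_simps)
  next
    case (incl A)
    then show ?case by (intro image_eqI[of _ _ 1]) auto
  next
    case (inv A)
    \<comment> \<open>The homomorphism law at \<open>- c\<close> and \<open>c\<close> exhibits
      \<open>M (- c)\<close> as a left inverse of the generator.\<close>
    have "inv\<^bsub>SL2R\<^esub> (M c) = M (- c)"
      using assms(1)[of "- c" c] assms by (intro inv_equality) (auto simp: SL2R_simps)
    then show ?case using inv by (intro image_eqI[of _ _ "-1"]) auto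
  next
    case (eng A B)
    then obtain m n :: int where "A = M (of_int m * c)" "B = M (of_int n * c)" by blast
    then show ?case
      using assms(1) by (intro image_eqI[of _ _ "m + n"]) (auto simp: SL2R_simps algebra_simps)
  qed
qed

text \<open>For nonzero \<open>c\<close> the integer is at most \<open>C / \<bar>c\<bar>\<close> in
  absolute value. For \<open>c = 0\<close> the only multiple is zero; this covers the trivial groups
  \<open>F1 0\<close> and \<open>F2 1\<close>.\<close>

lemma finite_bounded_multiples:
  fixes c C :: real
  shows "finite {t. (\<exists>n :: int. t = of_int n * c) \<and> \<bar>t\<bar> \<le> C}"
proof (cases "c = 0")
  case False
  have "{t. (\<exists>n :: int. t = of_int n * c) \<and> \<bar>t\<bar> \<le> C}
      \<subseteq> (\<lambda>n. of_int n * c) ` {- \<lceil>C / \<bar>c\<bar>\<rceil>..\<lceil>C / \<bar>c\<bar>\<rceil>}"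
  proof clarify
    fix n :: int assume "\<bar>of_int n * c\<bar> \<le> C"
    then have "\<bar>real_of_int n\<bar> \<le> C / \<bar>c\<bar>" using False by (simp add: abs_mult pos_le_divide_eq)
    then have "n \<in> {- \<lceil>C / \<bar>c\<bar>\<rceil>..\<lceil>C / \<bar>c\<bar>\<rceil>}" by (auto simp: le_ceiling_iff) linarith+
    then show "of_int n * c \<in> (\<lambda>n. of_int n * c) ` {- \<lceil>C / \<bar>c\<bar>\<rceil>..\<lceil>C / \<bar>c\<bar>\<rceil>}" by blast
  qed
  then show ?thesis using finite_subset by blast
qed (simp add: rev_finite_subset[of "{0}"] subset_iff)

text \<open>Discreteness comes from the sixth assumption: some entry of \<open>M t\<close> is at
  least as large as the parameter, so bounded entries leave only boundedly many multiples of
  \<open>c\<close>.\<close>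

lemma cyclic_upper_triangular:
  assumes "\<And>s t. M (s + t) = M s ** M t" "M 0 = mat 1" "\<And>t. det (M t) = 1"
    and "\<And>t. M t $ 2 $ 1 = 0" "\<And>t. 0 < M t $ 1 $ 1" "\<And>t. \<exists>i j. \<bar>t\<bar> \<le> \<bar>M t $ i $ j\<bar>"
    and F: "F = generate SL2R {M c}"
  shows "upper_triangular_subgroup F" "finite {A \<in> F. \<forall>i j. \<bar>A $ i $ j\<bar> \<le> C}"
proof -
  note sub = cyclic_subset_one_parameter[of M c, OF assms(1-3), folded F]
  interpret group SL2R by (rule group_SL2R)
  show "upper_triangular_subgroup F"
  proof (rule upper_triangular_subgroup.intro)
    show "subgroup F SL2R"
      unfolding F using assms(3) by (intro generate_is_subgroup) (auto simp: SL2R_simps)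
  qed (use sub assms(4,5) in auto)
  have "{A \<in> F. \<forall>i j. \<bar>A $ i $ j\<bar> \<le> C}
      \<subseteq> M ` {t. (\<exists>n :: int. t = of_int n * c) \<and> \<bar>t\<bar> \<le> C}"
  proof clarify
    fix A assume A: "A \<in> F" "\<forall>i j. \<bar>A $ i $ j\<bar> \<le> C"
    then obtain n :: int where n: "A = M (of_int n * c)" using sub by blast
    have "\<bar>of_int n * c\<bar> \<le> C" using assms(6)[of "of_int n * c"] A(2) n by (meson order_trans)
    then show "A \<in> M ` {t. (\<exists>n :: int. t = of_int n * c) \<and> \<bar>t\<bar> \<le> C}" using n by blast
  qed
  then show "finite {A \<in> F. \<forall>i j. \<bar>A $ i $ j\<bar> \<le> C}"
    using finite_bounded_multiples finite_subset by blast
qed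

lemma F1_upper_triangular:
  "upper_triangular_subgroup (F1 s)" "finite {A \<in> F1 s. \<forall>i j. \<bar>A $ i $ j\<bar> \<le> C}"
proof -
  define M :: "real \<Rightarrow> real^2^2" where "M t = vector [vector [1, t], vector [0, 1]]" for t
  have add: "M (s + t) = M s ** M t" for s t
    by (simp add: M_def vec_eq_iff forall_2 matrix_matrix_mult_def sum_2)
  have "M 0 = mat 1" "\<And>t. det (M t) = 1" "\<And>t. M t $ 2 $ 1 = 0" "\<And>t. 0 < M t $ 1 $ 1"
    by (simp_all add: M_def vec_eq_iff forall_2 mat_def det_2)
  note M = cyclic_upper_triangular[of M, OF add this]
  have unbounded: "\<exists>i j. \<bar>t\<bar> \<le> \<bar>M t $ i $ j\<bar>" for t
    by (rule exI[of _ 1], rule exI[of _ 2]) (simp add: M_def)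
  have F: "F1 s = generate SL2R {M s}" by (simp add: F1_def M_def)
  show "upper_triangular_subgroup (F1 s)" "finite {A \<in> F1 s. \<forall>i j. \<bar>A $ i $ j\<bar> \<le> C}"
    by (rule M[OF unbounded F])+
qed

text \<open>Taking \<open>t = ln l\<close> as parameter turns the diagonal matrices into a
  one-parameter group.\<close>

lemma F2_upper_triangular:
  assumes "0 < l"
  shows "upper_triangular_subgroup (F2 l)" "finite {A \<in> F2 l. \<forall>i j. \<bar>A $ i $ j\<bar> \<le> C}"
proof -
  define M :: "real \<Rightarrow> real^2^2" where
    "M t = vector [vector [exp t, 0], vector [0, exp (- t)]]" for t
  have add: "M (s + t) = M s ** M t" for s t
    by (simp add: M_def vec_eq_iff forall_2 matrix_matrix_mult_def sum_2 flip: exp_add)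
  have "M 0 = mat 1" "\<And>t. det (M t) = 1" "\<And>t. M t $ 2 $ 1 = 0" "\<And>t. 0 < M t $ 1 $ 1"
    by (simp_all add: M_def vec_eq_iff forall_2 mat_def det_2 flip: exp_add)
  note M = cyclic_upper_triangular[of M, OF add this]
  \<comment> \<open>The inequality \<open>1 + x \<le> exp x\<close> is applied to the larger
    diagonal entry, which is the upper one for \<open>t \<ge> 0\<close> and the lower one
    otherwise.\<close>
  have unbounded: "\<exists>i j. \<bar>t\<bar> \<le> \<bar>M t $ i $ j\<bar>" for t
  proof (cases "0 \<le> t")
    case True
    then have "\<bar>t\<bar> \<le> \<bar>M t $ 1 $ 1\<bar>" using exp_ge_add_one_self[of t] by (simp add: M_def del: exp_ge_add_one_self)
    then show ?thesis by blast
  next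
    case False
    then have "\<bar>t\<bar> \<le> \<bar>M t $ 2 $ 2\<bar>"
      using exp_ge_add_one_self[of "- t"] by (simp add: M_def del: exp_ge_add_one_self)
    then show ?thesis by blast
  qed
  have F: "F2 l = generate SL2R {M (ln l)}"
    using assms by (simp add: F2_def M_def exp_minus inverse_eq_divide)
  show "upper_triangular_subgroup (F2 l)" "finite {A \<in> F2 l. \<forall>i j. \<bar>A $ i $ j\<bar> \<le> C}"
    by (rule M[OF unbounded F])+
qed

section \<open>The invariant coframes\<close>

lemma \<alpha>_simps:
  "\<alpha>1 p u = (cos (snd p) * Re (fst u) + sin (snd p) * Im (fst u)) / Im (fst p)"
  "\<alpha>2 p u = (- sin (snd p) * Re (fst u) + cos (snd p) * Im (fst u)) / Im (fst p)"
  "\<alpha>3 p u = - snd u - Re (fst u) / Im (fst p)"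
  by (simp_all add: \<alpha>1_def \<alpha>2_def \<alpha>3_def case_prod_beta)

text \<open>The form \<open>\<omega>\<^sup>2\<close> for \<open>\<phi> = 2 dx/y\<close>.\<close>

definition \<eta> :: "(complex \<times> real) form1" where
  "\<eta> p u = snd u - Re (fst u) / Im (fst p)"

lemma smooth_forms:
  "smooth_form1_on SL2_tilde \<alpha>1" "smooth_form1_on SL2_tilde \<alpha>2"
  "smooth_form1_on SL2_tilde \<alpha>3" "smooth_form1_on SL2_tilde \<eta>"
proof -
  have Im: "Im (fst p) \<noteq> 0" if "p \<in> SL2_tilde" for p :: "complex \<times> real"
    using that by (simp add: mem_SL2_tilde)
  have "linear (\<alpha>1 p)" "linear (\<alpha>2 p)" "linear (\<alpha>3 p)" "linear (\<eta> p)" for p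
    by (rule linearI; simp add: \<alpha>_simps \<eta>_def add_divide_distrib diff_divide_distrib algebra_simps)+
  moreover have "smooth_on SL2_tilde (\<lambda>p. \<alpha>1 p u)" "smooth_on SL2_tilde (\<lambda>p. \<alpha>2 p u)"
    "smooth_on SL2_tilde (\<lambda>p. \<alpha>3 p u)" "smooth_on SL2_tilde (\<lambda>p. \<eta> p u)" for u
    unfolding \<alpha>_simps \<eta>_def diff_conv_add_uminus by (intro smooth_on_SL2_tilde_intros Im; assumption)+
  ultimately show "smooth_form1_on SL2_tilde \<alpha>1" "smooth_form1_on SL2_tilde \<alpha>2"
    "smooth_form1_on SL2_tilde \<alpha>3" "smooth_form1_on SL2_tilde \<eta>"
    unfolding smooth_form1_on_def by blast+
qed

lemma sin_cos_shift:
  "sin (t + 2 * pi * of_int k) = sin t" "cos (t + 2 * pi * of_int k) = cos t"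
  by (simp_all add: sin_add cos_add)

text \<open>The horizontal components of a tangent vector and the height \<open>Im z\<close> are
  multiplied by the same \<open>a\<close>, which cancels in each quotient; the deck shift disappears
  by periodicity.\<close>

lemma pullback_affine_lift:
  assumes "0 < a" "p \<in> SL2_tilde"
  shows "pullback (affine_lift a b k) \<alpha>1 p u = \<alpha>1 p u"
    "pullback (affine_lift a b k) \<alpha>2 p u = \<alpha>2 p u"
    "pullback (affine_lift a b k) \<alpha>3 p u = \<alpha>3 p u"
    "pullback (affine_lift a b k) \<eta> p u = \<eta> p u"
  using assms
  unfolding pullback_def \<alpha>_simps \<eta>_def
  by (simp_all add: affine_lift_apply sin_cos_shift frechet_derivative_at[OF has_derivative_affine_lift, symmetric])
     (simp_all add: mem_SL2_tilde field_simps)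

text \<open>In \<open>\<omega>'\<close> the first vector is the direction of differentiation and the
  second is the argument of the form.\<close>

lemma ext_deriv_eq:
  assumes "\<And>u. ((\<lambda>q. \<omega> q u) has_derivative (\<lambda>w. \<omega>' w u)) (at p)"
  shows "ext_deriv \<omega> p u w = \<omega>' u w - \<omega>' w u"
  by (simp add: ext_deriv_def frechet_derivative_at[OF assms, symmetric])

text \<open>\<open>\<eta>\<close> and \<open>\<alpha>3\<close> differ by twice the closed form
  \<open>d\<theta>\<close>, hence share their exterior derivative.\<close>

lemma ext_deriv_forms:
  assumes "p \<in> SL2_tilde"
  shows "ext_deriv \<alpha>1 p u w = (\<alpha>2 \<and>\<^sub>F \<alpha>3) p u w" "ext_deriv \<alpha>2 p u w = (\<alpha>3 \<and>\<^sub>F \<alpha>1) p u w"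
    "ext_deriv \<alpha>3 p u w = - (\<alpha>1 \<and>\<^sub>F \<alpha>2) p u w" "ext_deriv \<eta> p u w = - (\<alpha>1 \<and>\<^sub>F \<alpha>2) p u w"
proof -
  define y c s where "y = Im (fst p)" and "c = cos (snd p)" and "s = sin (snd p)"
  have y: "y \<noteq> 0" using assms by (simp add: mem_SL2_tilde y_def)
  have trig: "s * s + c * c = 1" by (simp add: s_def c_def flip: power2_eq_square)
  note simps = \<alpha>_simps wedge_def y_def[symmetric] c_def[symmetric] s_def[symmetric]
  have "((\<lambda>q. \<alpha>1 q u) has_derivative
      (\<lambda>w. ((- s * Re (fst u) + c * Im (fst u)) * snd w * y
          - (c * Re (fst u) + s * Im (fst u)) * Im (fst w)) / (y * y))) (at p)" for u
    unfolding \<alpha>_simps y_def c_def s_def using y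
    by (auto simp: y_def field_simps intro!: derivative_eq_intros)
  from ext_deriv_eq[of \<alpha>1, OF this] show "ext_deriv \<alpha>1 p u w = (\<alpha>2 \<and>\<^sub>F \<alpha>3) p u w"
    using y by (simp add: simps field_simps)
  have "((\<lambda>q. \<alpha>2 q u) has_derivative
      (\<lambda>w. ((- c * Re (fst u) - s * Im (fst u)) * snd w * y
          - (- s * Re (fst u) + c * Im (fst u)) * Im (fst w)) / (y * y))) (at p)" for u
    unfolding \<alpha>_simps y_def c_def s_def using y
    by (auto simp: y_def field_simps intro!: derivative_eq_intros)
  from ext_deriv_eq[of \<alpha>2, OF this] show "ext_deriv \<alpha>2 p u w = (\<alpha>3 \<and>\<^sub>F \<alpha>1) p u w"
    using y by (simp add: simps field_simps)
  \<comment> \<open>The hyperbolic area form \<open>dx dy / y^2\<close>: the rotation by the angle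
    has determinant one and drops out.\<close>
  have area: "(\<alpha>1 \<and>\<^sub>F \<alpha>2) p u w = (Re (fst u) * Im (fst w) - Re (fst w) * Im (fst u)) / (y * y)"
  proof -
    have "(\<alpha>1 \<and>\<^sub>F \<alpha>2) p u w
        = (s * s + c * c) * (Re (fst u) * Im (fst w) - Re (fst w) * Im (fst u)) / (y * y)"
      using y by (simp add: simps field_simps)
    then show ?thesis by (simp add: trig)
  qed
  have "((\<lambda>q. \<alpha>3 q u) has_derivative (\<lambda>w. Re (fst u) * Im (fst w) / (y * y))) (at p)" for u
    unfolding \<alpha>_simps y_def using y
    by (auto simp: y_def field_simps intro!: derivative_eq_intros)
  from ext_deriv_eq[of \<alpha>3, OF this] show "ext_deriv \<alpha>3 p u w = - (\<alpha>1 \<and>\<^sub>F \<alpha>2) p u w"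
    using y by (simp add: area field_simps)
  have "((\<lambda>q. \<eta> q u) has_derivative (\<lambda>w. Re (fst u) * Im (fst w) / (y * y))) (at p)" for u
    unfolding \<eta>_def y_def using y
    by (auto simp: y_def field_simps intro!: derivative_eq_intros)
  from ext_deriv_eq[of \<eta>, OF this] show "ext_deriv \<eta> p u w = - (\<alpha>1 \<and>\<^sub>F \<alpha>2) p u w"
    using y by (simp add: area field_simps)
qed

text \<open>The angular direction sees only \<open>\<alpha>3\<close>, so \<open>c\<close> vanishes.
  The two horizontal directions then give a rotation system for \<open>a\<close> and
  \<open>b\<close>, which is invertible.\<close>

lemma \<alpha>_independent:
  assumes "p \<in> SL2_tilde" "\<forall>u. a * \<alpha>1 p u + b * \<alpha>2 p u + c * \<alpha>3 p u = 0"
  shows "a = 0 \<and> b = 0 \<and> c = 0"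
proof -
  have y: "Im (fst p) \<noteq> 0" using assms(1) by (simp add: mem_SL2_tilde)
  let ?c = "cos (snd p)" and ?s = "sin (snd p)"
  have c: "c = 0" using assms(2)[rule_format, of "(0, 1)"] by (simp add: \<alpha>_simps)
  have 1: "a * ?c - b * ?s = 0"
    using assms(2)[rule_format, of "(1, 0)"] y c by (simp add: \<alpha>_simps field_simps)
  have 2: "a * ?s + b * ?c = 0"
    using assms(2)[rule_format, of "(\<i>, 0)"] y c by (simp add: \<alpha>_simps field_simps)
  have "a * (?s\<^sup>2 + ?c\<^sup>2) = 0" "b * (?s\<^sup>2 + ?c\<^sup>2) = 0" using 1 2 by algebra+
  then show ?thesis using c by simp
qed

text \<open>Rotating \<open>\<alpha>1\<close> and \<open>\<alpha>2\<close> back recovers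
  \<open>dx/y\<close>, and \<open>\<eta>\<close> is \<open>-2 dx/y - \<alpha>3\<close>. The two
  trigonometric coefficients become \<open>I\<close> and \<open>J\<close>.\<close>

lemma \<eta>_eq:
  assumes "p \<in> SL2_tilde"
  shows "\<eta> p u = - 2 * cos (snd p) * \<alpha>1 p u + 2 * sin (snd p) * \<alpha>2 p u - \<alpha>3 p u"
proof -
  let ?c = "cos (snd p)" and ?s = "sin (snd p)"
  have "?c * \<alpha>1 p u - ?s * \<alpha>2 p u = (?s\<^sup>2 + ?c\<^sup>2) * Re (fst u) / Im (fst p)"
    using assms unfolding \<alpha>_simps by (simp add: mem_SL2_tilde field_simps power2_eq_square
        del: sin_cos_squared_add sin_cos_squared_add2 sin_cos_squared_add3)
  then have "?c * \<alpha>1 p u - ?s * \<alpha>2 p u = Re (fst u) / Im (fst p)" by simp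
  then show ?thesis by (simp add: \<eta>_def \<alpha>_simps(3))
qed

theorem proposition6p12:
  fixes s l :: real and F :: "(real^2^2) set"
    and \<Gamma> :: "(complex \<times> real \<Rightarrow> complex \<times> real) set"
  assumes "F = F1 s \<or> (0 < l \<and> F = F2 l)"
    and "\<Gamma> = lift F"
  shows "quotient_is_manifold \<Gamma> \<and>
    minus_one_cartan_structure \<Gamma> \<alpha>1 \<alpha>2 \<alpha>3 \<and>
    (\<exists>(f :: complex \<Rightarrow> real) (g :: complex \<Rightarrow> real).
       smooth_on \<H>\<^sup>2 f \<and> smooth_on \<H>\<^sup>2 g \<and> invariant_under F f \<and> invariant_under F g \<and>
       (let D = (\<lambda>z. - Im z * partial_y f z + f z + Im z * partial_x g z - 1);
            v = (\<lambda>z. D z powr (- 1 / 2));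
            \<phi> = (\<lambda>z w. (f z * Re w + g z * Im w) / Im z);
            \<omega>1 = (\<lambda>p u. 1 / v (fst p) * \<alpha>1 p u);
            \<omega>2 = (\<lambda>p u. - pullback fst \<phi> p u - \<alpha>3 p u);
            \<omega>3 = (\<lambda>p u. 1 / v (fst p) * \<alpha>2 p u)
        in (\<forall>z\<in>\<H>\<^sup>2. 0 < D z) \<and>
           (\<exists>I J. nontrivial_IJ1_generalized_Finsler_structure \<Gamma> I J \<omega>1 \<omega>2 \<omega>3)))"
proof -
  interpret upper_triangular_subgroup F
    using assms(1) F1_upper_triangular(1) F2_upper_triangular(1) by blast
  \<comment> \<open>All invariance checks below, for forms and for functions, use only this
    description of the elements.\<close>
  have \<Gamma>: "\<exists>a b k. 0 < a \<and> \<gamma> = affine_lift a b k" if \<gamma>: "\<gamma> \<in> \<Gamma>" for \<gamma>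
  proof -
    obtain A k where "A \<in> F" "\<gamma> = matrix_lift A k"
      using \<gamma> unfolding assms(2) lift_eq by blast
    then show ?thesis using upper_left[of A] unfolding matrix_lift_def by (metis zero_less_power)
  qed
  have forms: "smooth_form1_on_quotient \<Gamma> \<alpha>1" "smooth_form1_on_quotient \<Gamma> \<alpha>2"
    "smooth_form1_on_quotient \<Gamma> \<alpha>3" "smooth_form1_on_quotient \<Gamma> \<eta>"
    using \<Gamma> by (auto simp: smooth_form1_on_quotient_def smooth_forms dest!: \<Gamma> simp: pullback_affine_lift)
  have manifold: "quotient_is_manifold \<Gamma>"
    unfolding assms(2)
    using assms(1) F1_upper_triangular(2) F2_upper_triangular(2)
    by (intro quotient_is_manifold_lift) blast
  have cartan: "minus_one_cartan_structure \<Gamma> \<alpha>1 \<alpha>2 \<alpha>3"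
    unfolding minus_one_cartan_structure_def coframe_on_quotient_def
    using forms ext_deriv_forms \<alpha>_independent by blast
  define I J :: "complex \<times> real \<Rightarrow> real"
    where "I p = - 2 * cos (snd p)" and "J p = 2 * sin (snd p)" for p
  have "smooth_on SL2_tilde I" "smooth_on SL2_tilde J"
    unfolding I_def J_def by (intro smooth_on_SL2_tilde_intros)+
  then have IJ: "smooth_fun_on_quotient \<Gamma> I" "smooth_fun_on_quotient \<Gamma> J"
    unfolding smooth_fun_on_quotient_def I_def J_def
    by (auto dest!: \<Gamma> simp: affine_lift_apply sin_cos_shift)
  have \<eta>: "\<eta> p u = I p * \<alpha>1 p u + J p * \<alpha>2 p u - \<alpha>3 p u" if "p \<in> SL2_tilde" for p u
    using \<eta>_eq[OF that] by (simp add: I_def J_def)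
  have coframe: "coframe_on_quotient \<Gamma> \<alpha>1 \<eta> \<alpha>2"
    unfolding coframe_on_quotient_def
  proof (intro conjI ballI allI impI forms)
    fix p :: "complex \<times> real" and a b c
    assume p: "p \<in> SL2_tilde" and *: "\<forall>u. a * \<alpha>1 p u + b * \<eta> p u + c * \<alpha>2 p u = 0"
    \<comment> \<open>The relation is rewritten in the independent forms; the coefficient of
      \<open>\<alpha>3\<close> gives \<open>b = 0\<close>, and then the other two give
      \<open>a\<close> and \<open>c\<close>.\<close>
    have "\<forall>u. (a + b * I p) * \<alpha>1 p u + (c + b * J p) * \<alpha>2 p u + (- b) * \<alpha>3 p u = 0"
      using * by (simp add: \<eta>[OF p] algebra_simps)
    from \<alpha>_independent[OF p this] show "a = 0" "b = 0" "c = 0" by auto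
  qed
  \<comment> \<open>Wedging \<open>\<eta> = I \<alpha>1 + J \<alpha>2 - \<alpha>3\<close> with
    \<open>\<alpha>2\<close> leaves an \<open>I\<close> term, and with \<open>\<alpha>1\<close> a
    \<open>J\<close> term. The corrections in the structure equations cancel exactly these, which
    reduces them to the Cartan equations.\<close>
  have "ext_deriv \<alpha>1 p u w = - I p * (\<alpha>1 \<and>\<^sub>F \<alpha>2) p u w + (\<eta> \<and>\<^sub>F \<alpha>2) p u w"
    "ext_deriv \<eta> p u w = - (\<alpha>1 \<and>\<^sub>F \<alpha>2) p u w"
    "ext_deriv \<alpha>2 p u w = (\<alpha>1 \<and>\<^sub>F \<eta>) p u w - J p * (\<alpha>1 \<and>\<^sub>F \<alpha>2) p u w"
    if "p \<in> SL2_tilde" for p u w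
    by (simp_all add: ext_deriv_forms[OF that] wedge_def \<eta>[OF that] algebra_simps)
  then have "IJ1_generalized_Finsler_structure \<Gamma> I J \<alpha>1 \<eta> \<alpha>2"
    unfolding IJ1_generalized_Finsler_structure_def using IJ coframe by blast
  \<comment> \<open>Two angles over the same base point separate the values: cosine at
    \<open>0\<close> and \<open>pi\<close>, sine at \<open>0\<close> and
    \<open>pi / 2\<close>.\<close>
  moreover have "I (\<i>, 0) \<noteq> I (\<i>, pi)" "J (\<i>, 0) \<noteq> J (\<i>, pi / 2)"
    by (simp_all add: I_def J_def)
  moreover have "(\<i>, t) \<in> SL2_tilde" for t by (simp add: mem_SL2_tilde)
  ultimately have Finsler: "nontrivial_IJ1_generalized_Finsler_structure \<Gamma> I J \<alpha>1 \<eta> \<alpha>2"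
    unfolding nontrivial_IJ1_generalized_Finsler_structure_def constant_on_def by metis
  have "frechet_derivative fst (at p) = (fst :: complex \<times> real \<Rightarrow> complex)" for p
    by (intro frechet_derivative_at[symmetric] bounded_linear_imp_has_derivative bounded_linear_fst)
  \<comment> \<open>The zero term for \<open>g\<close> is kept so that the left side matches the
    second form of the goal literally once the witnesses are inserted.\<close>
  then have \<omega>2: "(\<lambda>p u. - pullback fst (\<lambda>z w. (2 * Re w + 0 * Im w) / Im z) p u - \<alpha>3 p u) = \<eta>"
    by (intro ext) (simp add: pullback_def \<eta>_def \<alpha>_simps)
  have D: "- Im z * partial_y (\<lambda>_. 2) z + 2 + Im z * partial_x (\<lambda>_. 0) z - 1 = 1" for z
    by (simp add: partial_x_def partial_y_def)
  \<comment> \<open>Since \<open>D\<close> is constantly one, the factor \<open>1 / v\<close>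
    disappears and the first and third forms become \<open>\<alpha>1\<close> and
    \<open>\<alpha>2\<close>.\<close>
  have one: "1 / (1 :: real) powr (- 1 / 2) * x = x" for x by simp
  show ?thesis
    by (intro conjI manifold cartan, rule exI[of _ "\<lambda>_. 2"], rule exI[of _ "\<lambda>_. 0"],
        unfold Let_def D \<omega>2 one)
      (use Finsler in \<open>auto simp: invariant_under_def smooth_on_const\<close>)
qed

end
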